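(* Let $G$ be a weighted connected graph on $n+1$ vertices, let $v$ be a vertex of $G$ that is not a cut-vertex, and let $M$ be the bottleneck matrix at $v$ (an $n\times n$ matrix). Let $\mathbf{x}\in\mathbb{R}^n_{++}$ and suppose $\mathbf{x}$ is not a Perron vector of $M$. Then $(a_k(M,\mathbf{x}))_{k\ge1}$ is a strictly decreasing sequence converging to $\rho(M)$, and $(b_k(M,\mathbf{x}))_{k\ge1}$ and $(c_k(M,\mathbf{x}))_{k\ge1}$ are strictly increasing sequences converging to $\rho(M)$.
   Context: Let $G$ be a connected graph with positive edge weights. Its Laplacian $L(G)$ has $(i,j)$ entry equal to minus the weight of edge $ij$ if $i\ne j$ are adjacent, $0$ if $i\neq j$ are nonadjacent, and the diagonal entry at $i$ equal to the sum of the weights of edges incident to $i$. The bottleneck matrix at a vertex $v$ is the inverse of the matrix obtained from $L(G)$ by deleting the row and column indexed by $v$. A cut-vertex is a vertex whose removal (with incident edges) disconnects the graph. $\mathbb{R}^n_{++}$ is the set of entrywise positive vectors; $\rho(M)$ is the spectral radius and a Perron vector is an eigenvector for $\rho(M)$. For $k\ge1$: $a_k(M,\mathbf{x})=\max_i\frac{(M^k\mathbf{x})_i}{(M^{k-1}\mathbf{x})_i}$, $b_k(M,\mathbf{x})=\min_i\frac{(M^k\mathbf{x})_i}{(M^{k-1}\mathbf{x})_i}$, $c_k(M,\mathbf{x})=\frac{\mathbf{x}^TM^k\mathbf{x}}{\mathbf{x}^TM^{k-1}\mathbf{x}}$. *)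

theory Defs
  imports
    "Graph_Theory.Graph_Theory"
    "Jordan_Normal_Form.Gauss_Jordan_Elimination"
    "Jordan_Normal_Form.Determinant"
    "Jordan_Normal_Form.Spectral_Radius"
begin

text \<open>
  The \<^locale>\<open>pair_graph\<close> \<open>G\<close> is a finite simple graph, each edge \<open>ij\<close> being represented by the
  two arcs \<open>(i, j)\<close> and \<open>(j, i)\<close>; the values of \<open>w\<close> off the edges are irrelevant.
\<close>

locale weighted_pair_graph = pair_graph G
  for G :: "'a pair_pre_digraph" +
  fixes w :: "'a \<Rightarrow> 'a \<Rightarrow> real"
  assumes weight_sym: "(i, j) \<in> parcs G \<Longrightarrow> w i j = w j i"
    and weight_pos: "(i, j) \<in> parcs G \<Longrightarrow> 0 < w i j"

text \<open>\<open>connected\<close> has to be qualified because of the topological notion of the same name.\<close>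

definition cut_vertex :: "'a pair_pre_digraph \<Rightarrow> 'a \<Rightarrow> bool" where
  "cut_vertex G v \<longleftrightarrow>
     v \<in> pverts G \<and> \<not> Digraph_Component.connected (pre_digraph.del_vert (with_proj G) v)"

text \<open>Rows and columns are indexed by the vertices, so this is for \<open>pverts G = {..<card (pverts G)}\<close>.\<close>

definition laplacian :: "nat pair_pre_digraph \<Rightarrow> (nat \<Rightarrow> nat \<Rightarrow> real) \<Rightarrow> real mat" where
  "laplacian G w = mat (card (pverts G)) (card (pverts G)) (\<lambda>(i, j).
     if i = j then \<Sum>k | (i, k) \<in> parcs G. w i k
     else if (i, j) \<in> parcs G then - w i j
     else 0)"

definition bottleneck_matrix ::
    "nat pair_pre_digraph \<Rightarrow> (nat \<Rightarrow> nat \<Rightarrow> real) \<Rightarrow> nat \<Rightarrow> real mat" where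
  "bottleneck_matrix G w v = the (mat_inverse (mat_delete (laplacian G w) v v))"

definition real_spectral_radius :: "real mat \<Rightarrow> real" where
  "real_spectral_radius M = spectral_radius (map_mat complex_of_real M)"

definition perron_vector :: "real mat \<Rightarrow> real vec \<Rightarrow> bool" where
  "perron_vector M x \<longleftrightarrow> eigenvector M x (real_spectral_radius M)"

text \<open>The following three sequences are meant for \<open>k \<ge> 1\<close> only.\<close>

definition a_seq :: "real mat \<Rightarrow> real vec \<Rightarrow> nat \<Rightarrow> real" where
  "a_seq M x k = (MAX i\<in>{..<dim_vec x}.
     ((M ^\<^sub>m k) *\<^sub>v x) $ i / ((M ^\<^sub>m (k - 1)) *\<^sub>v x) $ i)"

definition b_seq :: "real mat \<Rightarrow> real vec \<Rightarrow> nat \<Rightarrow> real" where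
  "b_seq M x k = (MIN i\<in>{..<dim_vec x}.
     ((M ^\<^sub>m k) *\<^sub>v x) $ i / ((M ^\<^sub>m (k - 1)) *\<^sub>v x) $ i)"

definition c_seq :: "real mat \<Rightarrow> real vec \<Rightarrow> nat \<Rightarrow> real" where
  "c_seq M x k = (x \<bullet> ((M ^\<^sub>m k) *\<^sub>v x)) / (x \<bullet> ((M ^\<^sub>m (k - 1)) *\<^sub>v x))"

end

theory Submission
  imports Defs
begin

text \<open>
  The matrix \<open>A\<close> obtained from the Laplacian by deleting row and column \<open>v\<close> is positive definite because the
  energy \<open>\<Sum> w\<^sub>i\<^sub>k (z\<^sub>i - z\<^sub>k)\<^sup>2\<close> vanishes only on constants, and its inverse \<open>M\<close> is entrywise positive by the
  minimum principle, which needs the graph without \<open>v\<close> to be connected. For such \<open>M\<close>, multiplying the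
  inequality \<open>M y \<le> a y\<close> by \<open>M\<close> makes it strict, which gives the strict monotonicity of the extreme ratios;
  their gap contracts geometrically, and the common limit is an eigenvalue that bounds the moduli of all
  others. The Rayleigh quotients lie between the extreme ratios and increase by strict Cauchy--Schwarz.
\<close>

section \<open>Matrix-vector products and powers\<close>

lemma mult_mat_vec_index_sum:
  assumes "A \<in> carrier_mat m n" "y \<in> carrier_vec n" "i < m"
  shows "(A *\<^sub>v y) $ i = (\<Sum>j<n. A $$ (i, j) * y $ j)"
  using assms by (simp add: scalar_prod_def atLeast0LessThan)

text \<open>\<open>pow_mat\<close> appends the new factor on the right; with it moved to the left,
  each iterate is \<open>A\<close> applied to the previous one.\<close>

lemma pow_mat_Suc_mult_vec:
  assumes A: "A \<in> carrier_mat n n" and y: "y \<in> carrier_vec n"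
  shows "(A ^\<^sub>m Suc k) *\<^sub>v y = A *\<^sub>v ((A ^\<^sub>m k) *\<^sub>v y)"
  using y
proof (induction k arbitrary: y)
  case 0
  then show ?case using A by simp
next
  case (Suc k)
  have "(A ^\<^sub>m Suc (Suc k)) *\<^sub>v y = (A ^\<^sub>m Suc k) *\<^sub>v (A *\<^sub>v y)"
    using A Suc.prems pow_carrier_mat[OF A, of "Suc k"]
    by (metis assoc_mult_mat_vec pow_mat.simps(2))
  also have "\<dots> = A *\<^sub>v ((A ^\<^sub>m k) *\<^sub>v (A *\<^sub>v y))"
    using A Suc.prems by (intro Suc.IH) auto
  also have "(A ^\<^sub>m k) *\<^sub>v (A *\<^sub>v y) = (A ^\<^sub>m Suc k) *\<^sub>v y"
    using A Suc.prems pow_carrier_mat[OF A, of k]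
    by (metis assoc_mult_mat_vec pow_mat.simps(2))
  finally show ?case .
qed

section \<open>Entrywise positive matrices and their extreme ratios\<close>

locale positive_matrix =
  fixes M :: "real mat" and n :: nat
  assumes M_carrier: "M \<in> carrier_mat n n"
    and n_pos: "0 < n"
    and M_pos: "\<And>i j. i < n \<Longrightarrow> j < n \<Longrightarrow> 0 < M $$ (i, j)"
begin

definition pos_vec :: "real vec \<Rightarrow> bool" where
  "pos_vec y \<longleftrightarrow> y \<in> carrier_vec n \<and> (\<forall>i<n. 0 < y $ i)"

text \<open>The Collatz--Wielandt bounds: at \<open>(M ^\<^sub>m k) *\<^sub>v x\<close> this ratio
  and \<open>min_ratio\<close> become \<open>a_seq M x (Suc k)\<close> and
  \<open>b_seq M x (Suc k)\<close>.\<close>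

definition max_ratio :: "real vec \<Rightarrow> real" where
  "max_ratio y = (MAX i\<in>{..<n}. (M *\<^sub>v y) $ i / y $ i)"

definition min_ratio :: "real vec \<Rightarrow> real" where
  "min_ratio y = (MIN i\<in>{..<n}. (M *\<^sub>v y) $ i / y $ i)"

lemma lessThan_n_ne: "{..<n} \<noteq> {}"
  using n_pos by auto

lemma mult_carrier: "y \<in> carrier_vec n \<Longrightarrow> M *\<^sub>v y \<in> carrier_vec n"
  using M_carrier by auto

lemma mult_pos_index:
  assumes "y \<in> carrier_vec n" "\<And>i. i < n \<Longrightarrow> 0 \<le> y $ i" "j < n" "0 < y $ j" "i < n"
  shows "0 < (M *\<^sub>v y) $ i"
  unfolding mult_mat_vec_index_sum[OF M_carrier assms(1,5)]
proof (rule sum_pos2[of _ j])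
  show "0 < M $$ (i, j) * y $ j" using assms M_pos by simp
  show "0 \<le> M $$ (i, k) * y $ k" if "k \<in> {..<n}" for k
    using assms M_pos[of i k] that by simp
qed (use assms in auto)

lemma pos_vec_mult: "pos_vec y \<Longrightarrow> pos_vec (M *\<^sub>v y)"
  unfolding pos_vec_def using mult_carrier mult_pos_index n_pos
  by (metis less_imp_le)

lemma pos_vec_pow: "pos_vec y \<Longrightarrow> pos_vec ((M ^\<^sub>m k) *\<^sub>v y)"
proof (induction k)
  case 0
  then show ?case using M_carrier by (simp add: pos_vec_def)
next
  case (Suc k)
  then show ?case
    using pos_vec_mult pow_mat_Suc_mult_vec[OF M_carrier] by (simp add: pos_vec_def del: pow_mat.simps)
qed

lemma mult_le_max_ratio:
  assumes "pos_vec y" "i < n"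
  shows "(M *\<^sub>v y) $ i \<le> max_ratio y * y $ i"
proof -
  have "(M *\<^sub>v y) $ i / y $ i \<le> max_ratio y"
    unfolding max_ratio_def using assms by (intro Max_ge) auto
  then show ?thesis using assms by (simp add: pos_vec_def divide_simps split: if_splits)
qed

lemma min_ratio_mult_le:
  assumes "pos_vec y" "i < n"
  shows "min_ratio y * y $ i \<le> (M *\<^sub>v y) $ i"
proof -
  have "min_ratio y \<le> (M *\<^sub>v y) $ i / y $ i"
    unfolding min_ratio_def using assms by (intro Min_le) auto
  then show ?thesis using assms by (simp add: pos_vec_def divide_simps split: if_splits)
qed

lemma max_ratio_attained:
  obtains i where "i < n" "max_ratio y = (M *\<^sub>v y) $ i / y $ i"
proof -
  have "max_ratio y \<in> (\<lambda>i. (M *\<^sub>v y) $ i / y $ i) ` {..<n}"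
    unfolding max_ratio_def using lessThan_n_ne by (intro Max_in) auto
  then show thesis using that by auto
qed

lemma min_ratio_attained:
  obtains i where "i < n" "min_ratio y = (M *\<^sub>v y) $ i / y $ i"
proof -
  have "min_ratio y \<in> (\<lambda>i. (M *\<^sub>v y) $ i / y $ i) ` {..<n}"
    unfolding min_ratio_def using lessThan_n_ne by (intro Min_in) auto
  then show thesis using that by auto
qed

lemma min_ratio_le_max_ratio: "min_ratio y \<le> max_ratio y"
proof -
  obtain i where "i < n" "min_ratio y = (M *\<^sub>v y) $ i / y $ i"
    by (rule min_ratio_attained)
  then show ?thesis unfolding max_ratio_def by (auto intro!: Max_ge)
qed

text \<open>The difference \<open>z - u\<close> is nonnegative and nonzero, and a positive matrix
  spreads a single positive entry to all coordinates. This is the device that turns weak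
  inequalities into strict ones.\<close>

lemma mult_diff_pos:
  assumes u: "u \<in> carrier_vec n" and z: "z \<in> carrier_vec n"
    and le: "\<And>i. i < n \<Longrightarrow> u $ i \<le> z $ i" and ne: "u \<noteq> z" and i: "i < n"
  shows "(M *\<^sub>v u) $ i < (M *\<^sub>v z) $ i"
proof -
  obtain j where j: "j < n" "u $ j \<noteq> z $ j"
    using ne u z by (metis carrier_vecD eq_vecI)
  have "0 < (M *\<^sub>v (z - u)) $ i"
    using u z le j i by (intro mult_pos_index[of _ j]) (auto simp: order.strict_iff_order)
  moreover have "M *\<^sub>v (z - u) = M *\<^sub>v z - M *\<^sub>v u"
    using mult_minus_distrib_mat_vec[OF M_carrier z u] .
  ultimately show ?thesis using M_carrier u z i by (auto simp del: index_mult_mat_vec)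
qed

text \<open>With \<open>a = max_ratio y\<close>, the vectors \<open>M *\<^sub>v y\<close> and
  \<open>a \<cdot>\<^sub>v y\<close> are ordered and distinct. A further factor \<open>M\<close>
  makes the order strict in every coordinate, including the one where the new ratio is
  attained.\<close>

lemma max_ratio_mult_less:
  assumes y: "pos_vec y" and ne: "\<And>c. M *\<^sub>v y \<noteq> c \<cdot>\<^sub>v y"
  shows "max_ratio (M *\<^sub>v y) < max_ratio y"
proof -
  obtain i where i: "i < n" "max_ratio (M *\<^sub>v y) = (M *\<^sub>v (M *\<^sub>v y)) $ i / (M *\<^sub>v y) $ i"
    by (rule max_ratio_attained)
  have yc: "y \<in> carrier_vec n" using y by (simp add: pos_vec_def)
  have "(M *\<^sub>v (M *\<^sub>v y)) $ i < (M *\<^sub>v (max_ratio y \<cdot>\<^sub>v y)) $ i"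
    using mult_le_max_ratio[OF y] yc mult_carrier[OF yc] ne i
    by (intro mult_diff_pos) (auto simp del: index_mult_mat_vec)
  also have "\<dots> = max_ratio y * (M *\<^sub>v y) $ i"
    using M_carrier yc i by (simp add: mult_mat_vec)
  finally show ?thesis
    unfolding i(2) using pos_vec_mult[OF y] i(1)
    by (subst pos_divide_less_eq) (auto simp: pos_vec_def)
qed

lemma min_ratio_mult_greater:
  assumes y: "pos_vec y" and ne: "\<And>c. M *\<^sub>v y \<noteq> c \<cdot>\<^sub>v y"
  shows "min_ratio y < min_ratio (M *\<^sub>v y)"
proof -
  obtain i where i: "i < n" "min_ratio (M *\<^sub>v y) = (M *\<^sub>v (M *\<^sub>v y)) $ i / (M *\<^sub>v y) $ i"
    by (rule min_ratio_attained)
  have yc: "y \<in> carrier_vec n" using y by (simp add: pos_vec_def)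
  have "(M *\<^sub>v (min_ratio y \<cdot>\<^sub>v y)) $ i < (M *\<^sub>v (M *\<^sub>v y)) $ i"
    using min_ratio_mult_le[OF y] yc mult_carrier[OF yc] ne[of "min_ratio y"] i
    by (intro mult_diff_pos) (auto simp del: index_mult_mat_vec)
  moreover have "(M *\<^sub>v (min_ratio y \<cdot>\<^sub>v y)) $ i = min_ratio y * (M *\<^sub>v y) $ i"
    using M_carrier yc i by (simp add: mult_mat_vec)
  ultimately show ?thesis
    unfolding i(2) using pos_vec_mult[OF y] i(1)
    by (subst pos_less_divide_eq) (auto simp: pos_vec_def)
qed

section \<open>Contraction of the gap between the extreme ratios\<close>

lemma rows_comparable:
  obtains q where "0 < q" "q \<le> 1"
    "\<And>i i' j. i < n \<Longrightarrow> i' < n \<Longrightarrow> j < n \<Longrightarrow> q * M $$ (i', j) \<le> M $$ (i, j)"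
proof -
  let ?E = "(\<lambda>(i, j). M $$ (i, j)) ` ({..<n} \<times> {..<n})"
  have fin: "finite ?E" "?E \<noteq> {}" using n_pos by auto
  have mn: "0 < Min ?E" using fin M_pos by auto
  have ent: "Min ?E \<le> M $$ (i, j)" "M $$ (i, j) \<le> Max ?E" if "i < n" "j < n" for i j
    using fin that by (auto intro!: Min_le Max_ge)
  have mx: "Min ?E \<le> Max ?E" using ent n_pos by (meson order_trans)
  \<comment> \<open>The constant is the smallest entry of \<open>M\<close> divided by the
    largest.\<close>
  show thesis
  proof (rule that)
    show "0 < Min ?E / Max ?E" "Min ?E / Max ?E \<le> 1" using mn mx by auto
    fix i i' j assume h: "i < n" "i' < n" "j < n"
    have "Min ?E / Max ?E * M $$ (i', j) \<le> Min ?E / Max ?E * Max ?E"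
      using mn mx ent h by (intro mult_left_mono) auto
    also have "\<dots> = Min ?E" using mn mx by simp
    also have "\<dots> \<le> M $$ (i, j)" using ent h by auto
    finally show "Min ?E / Max ?E * M $$ (i', j) \<le> M $$ (i, j)" .
  qed
qed

text \<open>The ratios of \<open>M *\<^sub>v y\<close> are averages of the ratios of \<open>y\<close>, and the weights belonging to any two rows are
  comparable up to a constant that depends only on \<open>M\<close>; so the gap shrinks by a fixed factor.\<close>

lemma ratio_gap_contraction:
  obtains q where "0 \<le> q" "q < 1"
    "\<And>y. pos_vec y \<Longrightarrow> max_ratio (M *\<^sub>v y) - min_ratio (M *\<^sub>v y) \<le> q * (max_ratio y - min_ratio y)"
proof -
  obtain c where c: "0 < c" "c \<le> 1"
    and cM: "\<And>i i' j. i < n \<Longrightarrow> i' < n \<Longrightarrow> j < n \<Longrightarrow> c * M $$ (i', j) \<le> M $$ (i, j)"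
    by (rule rows_comparable) blast
  \<comment> \<open>One factor \<open>c\<close> comes from comparing entries in two rows of
    \<open>M\<close>, the other from comparing the normalizers
    \<open>(M *\<^sub>v y) $ i\<close>.\<close>
  show thesis
  proof (rule that[of "1 - c * c"])
    show "0 \<le> 1 - c * c" "1 - c * c < 1" using c by (auto simp: mult_le_one)
    fix y assume y: "pos_vec y"
    have yc: "y \<in> carrier_vec n" using y by (simp add: pos_vec_def)
    let ?z = "M *\<^sub>v y"
    define t where "t j = ?z $ j / y $ j" for j
    \<comment> \<open>Each row of \<open>p\<close> is a probability vector, and the ratios of
      \<open>?z\<close> are the \<open>p\<close>-averages of the ratios \<open>t\<close>.\<close>
    define p where "p i j = M $$ (i, j) * y $ j / ?z $ i" for i j
    have zpos: "0 < ?z $ i" if "i < n" for i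
      using pos_vec_mult[OF y] that by (simp add: pos_vec_def)
    have ypos: "0 < y $ i" if "i < n" for i
      using y that by (simp add: pos_vec_def)
    have ratio: "(M *\<^sub>v ?z) $ i / ?z $ i = (\<Sum>j<n. p i j * t j)" if i: "i < n" for i
      unfolding mult_mat_vec_index_sum[OF M_carrier mult_carrier[OF yc] i] sum_divide_distrib
    proof (rule sum.cong)
      fix j assume "j \<in> {..<n}"
      then show "M $$ (i, j) * ?z $ j / ?z $ i = p i j * t j"
        using ypos[of j] by (simp add: p_def t_def del: index_mult_mat_vec)
    qed simp
    have psum: "(\<Sum>j<n. p i j) = 1" if i: "i < n" for i
      using zpos[OF i] mult_mat_vec_index_sum[OF M_carrier yc i]
      unfolding p_def sum_divide_distrib[symmetric] by (metis divide_self order_less_irrefl)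
    have t_le: "t j \<le> max_ratio y" and t_ge: "min_ratio y \<le> t j" if "j < n" for j
      using mult_le_max_ratio[OF y that] min_ratio_mult_le[OF y that] ypos[OF that]
      by (auto simp: t_def field_simps simp del: index_mult_mat_vec)
    have pp: "c * c * p i' j \<le> p i j" if h: "i < n" "i' < n" "j < n" for i i' j
    proof -
      have "c * ?z $ i \<le> ?z $ i'"
        unfolding mult_mat_vec_index_sum[OF M_carrier yc h(1)]
          mult_mat_vec_index_sum[OF M_carrier yc h(2)] sum_distrib_left
      proof (rule sum_mono)
        fix k assume "k \<in> {..<n}"
        then show "c * (M $$ (i, k) * y $ k) \<le> M $$ (i', k) * y $ k"
          using mult_right_mono[OF cM[OF h(2,1), of k], of "y $ k"] ypos[of k]
          by (simp add: mult.assoc)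
      qed
      then have inv: "c / ?z $ i' \<le> 1 / ?z $ i"
        using zpos[OF h(1)] zpos[OF h(2)] by (simp add: field_simps del: index_mult_mat_vec)
      have "c * c * p i' j = (c * M $$ (i', j)) * y $ j * (c / ?z $ i')"
        by (simp add: p_def del: index_mult_mat_vec)
      also have "\<dots> \<le> M $$ (i, j) * y $ j * (1 / ?z $ i)"
        using cM[OF h] inv c M_pos[OF h(1,3)] ypos[OF h(3)] zpos[OF h(2)]
        by (intro mult_mono mult_nonneg_nonneg) (auto simp del: index_mult_mat_vec)
      also have "\<dots> = p i j" by (simp add: p_def del: index_mult_mat_vec)
      finally show ?thesis .
    qed
    obtain i where i: "i < n" "max_ratio ?z = (M *\<^sub>v ?z) $ i / ?z $ i"
      by (rule max_ratio_attained)
    obtain i' where i': "i' < n" "min_ratio ?z = (M *\<^sub>v ?z) $ i' / ?z $ i'"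
      by (rule min_ratio_attained)
    have c2: "c * c \<le> 1" using c by (simp add: mult_le_one)
    have p_nonneg: "0 \<le> p i j" if "i < n" "j < n" for i j
      using M_pos[OF that] ypos[OF that(2)] zpos[OF that(1)]
      by (simp add: p_def del: index_mult_mat_vec)
    \<comment> \<open>The part \<open>c * c * p i' j\<close> common to both averages is split off.
      The remaining weights are nonnegative with sum \<open>1 - c * c\<close>, so their sum against
      \<open>t\<close> is at most that multiple of \<open>max_ratio y\<close>; the subtracted
      average is at least \<open>min_ratio y\<close>.\<close>
    have gap: "max_ratio ?z - min_ratio ?z
      = (\<Sum>j<n. (p i j - c * c * p i' j) * t j) - (1 - c * c) * (\<Sum>j<n. p i' j * t j)"
      unfolding i(2) i'(2) ratio[OF i(1)] ratio[OF i'(1)] sum_distrib_left sum_subtractf[symmetric]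
      by (simp add: algebra_simps)
    have "(\<Sum>j<n. (p i j - c * c * p i' j) * t j)
      \<le> (\<Sum>j<n. (p i j - c * c * p i' j) * max_ratio y)"
      using pp[OF i(1) i'(1)] t_le by (intro sum_mono mult_left_mono) auto
    also have "\<dots> = (1 - c * c) * max_ratio y"
      using psum[OF i(1)] psum[OF i'(1)]
      by (simp add: sum_distrib_right[symmetric] sum_subtractf sum_distrib_left[symmetric])
    finally have upper: "(\<Sum>j<n. (p i j - c * c * p i' j) * t j) \<le> (1 - c * c) * max_ratio y" .
    have lower: "(1 - c * c) * min_ratio y \<le> (1 - c * c) * (\<Sum>j<n. p i' j * t j)"
    proof (rule mult_left_mono)
      have "min_ratio y = (\<Sum>j<n. p i' j * min_ratio y)"
        using psum[OF i'(1)] by (simp add: sum_distrib_right[symmetric])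
      also have "\<dots> \<le> (\<Sum>j<n. p i' j * t j)"
        using t_ge p_nonneg[OF i'(1)] by (intro sum_mono mult_left_mono) auto
      finally show "min_ratio y \<le> (\<Sum>j<n. p i' j * t j)" .
    qed (use c2 in simp)
    show "max_ratio ?z - min_ratio ?z \<le> (1 - c * c) * (max_ratio y - min_ratio y)"
      using gap upper lower unfolding right_diff_distrib by linarith
  qed
qed

lemma ratio_gap_tendsto_0:
  assumes "pos_vec y"
  shows "(\<lambda>k. max_ratio ((M ^\<^sub>m k) *\<^sub>v y) - min_ratio ((M ^\<^sub>m k) *\<^sub>v y)) \<longlonglongrightarrow> 0"
    (is "?d \<longlonglongrightarrow> 0")
proof -
  obtain q where q: "0 \<le> q" "q < 1"
    and gap: "\<And>y. pos_vec y \<Longrightarrow>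
      max_ratio (M *\<^sub>v y) - min_ratio (M *\<^sub>v y) \<le> q * (max_ratio y - min_ratio y)"
    by (rule ratio_gap_contraction) blast
  have bound: "?d k \<le> q ^ k * ?d 0" for k
  proof (induction k)
    case (Suc k)
    have "?d (Suc k) \<le> q * ?d k"
      using gap[OF pos_vec_pow[OF assms, of k]] assms
      by (simp add: pow_mat_Suc_mult_vec[OF M_carrier] pos_vec_def del: pow_mat.simps)
    also have "\<dots> \<le> q * (q ^ k * ?d 0)" using q Suc by (intro mult_left_mono)
    finally show ?case by simp
  qed simp
  show ?thesis
  proof (rule tendsto_sandwich[of "\<lambda>_. 0" _ _ "\<lambda>k. q ^ k * ?d 0"])
    show "(\<lambda>k. q ^ k * ?d 0) \<longlonglongrightarrow> 0"
      using q by (intro tendsto_mult_left_zero LIMSEQ_power_zero) auto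
    show "\<forall>\<^sub>F k in sequentially. 0 \<le> ?d k" using min_ratio_le_max_ratio by simp
    show "\<forall>\<^sub>F k in sequentially. ?d k \<le> q ^ k * ?d 0" using bound by simp
  qed simp
qed

text \<open>The weak form covers every positive start: for an eigenvector the ratios do not change,
  otherwise the strict lemmas apply.\<close>

lemma ratio_mono:
  assumes y: "pos_vec y"
  shows "min_ratio y \<le> min_ratio (M *\<^sub>v y)" "max_ratio (M *\<^sub>v y) \<le> max_ratio y"
proof -
  have "min_ratio y \<le> min_ratio (M *\<^sub>v y) \<and> max_ratio (M *\<^sub>v y) \<le> max_ratio y"
  proof (cases "\<exists>c. M *\<^sub>v y = c \<cdot>\<^sub>v y")
    case True
    then obtain c where c: "M *\<^sub>v y = c \<cdot>\<^sub>v y" by blast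
    have yc: "y \<in> carrier_vec n" using y by (simp add: pos_vec_def)
    have "c * y $ 0 > 0" using pos_vec_mult[OF y] c n_pos yc by (auto simp: pos_vec_def)
    then have "c \<noteq> 0" by auto
    have "M *\<^sub>v (M *\<^sub>v y) = c \<cdot>\<^sub>v (M *\<^sub>v y)"
      using M_carrier yc by (simp add: c mult_mat_vec)
    then have "(M *\<^sub>v (M *\<^sub>v y)) $ i / (M *\<^sub>v y) $ i = (M *\<^sub>v y) $ i / y $ i" if "i < n" for i
      using c \<open>c \<noteq> 0\<close> yc that y by (simp add: pos_vec_def del: index_mult_mat_vec)
    then show ?thesis
      unfolding min_ratio_def max_ratio_def by (auto simp del: index_mult_mat_vec cong: image_cong_simp)
  next
    case False
    then show ?thesis
      using max_ratio_mult_less[OF y] min_ratio_mult_greater[OF y] by (auto intro: less_imp_le)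
  qed
  then show "min_ratio y \<le> min_ratio (M *\<^sub>v y)" "max_ratio (M *\<^sub>v y) \<le> max_ratio y" by auto
qed

section \<open>The spectral radius as the limit of the ratios\<close>

lemma spectral_radius_le_max_ratio:
  assumes y: "pos_vec y"
  shows "real_spectral_radius M \<le> max_ratio y"
proof -
  let ?C = "map_mat complex_of_real M"
  have C: "?C \<in> carrier_mat n n" using M_carrier by simp
  obtain m where m: "eigenvalue ?C m" "real_spectral_radius M = cmod m"
    using spectral_radius_mem_max(1)[OF C n_pos]
    unfolding real_spectral_radius_def spectrum_def by auto
  then obtain u where u: "u \<in> carrier_vec n" "u \<noteq> 0\<^sub>v n" "?C *\<^sub>v u = m \<cdot>\<^sub>v u"
    using C M_carrier unfolding eigenvalue_def eigenvector_def by auto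
  have ypos: "0 < y $ i" if "i < n" for i
    using y that by (simp add: pos_vec_def)
  \<comment> \<open>The least factor for which \<open>s\<close> times \<open>y\<close> dominates the
    moduli of \<open>u\<close>. Equality is attained at some index, and the triangle inequality in
    that row of the eigenvalue equation gives the bound.\<close>
  define s where "s = (MAX i\<in>{..<n}. cmod (u $ i) / y $ i)"
  have "s \<in> (\<lambda>i. cmod (u $ i) / y $ i) ` {..<n}"
    unfolding s_def using lessThan_n_ne by (intro Max_in) auto
  then obtain i where i: "i < n" "s = cmod (u $ i) / y $ i" by auto
  have s_le: "cmod (u $ j) \<le> s * y $ j" if "j < n" for j
  proof -
    have "cmod (u $ j) / y $ j \<le> s" unfolding s_def using that by (intro Max_ge) auto
    then show ?thesis using ypos[OF that] by (simp add: field_simps)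
  qed
  obtain j where "j < n" "u $ j \<noteq> 0" using u(1,2) by (metis carrier_vecD eq_vecI index_zero_vec)
  then have "0 < s * y $ j" using s_le[of j] by (smt (verit) zero_less_norm_iff)
  then have s: "0 < s" using ypos[OF \<open>j < n\<close>] by (simp add: zero_less_mult_iff)
  have "cmod m * (s * y $ i) = cmod (m * u $ i)"
    using i ypos[OF i(1)] by (simp add: norm_mult)
  also have "m * u $ i = (?C *\<^sub>v u) $ i" using u i by simp
  also have "\<dots> = (\<Sum>j<n. ?C $$ (i, j) * u $ j)" by (rule mult_mat_vec_index_sum[OF C u(1) i(1)])
  also have "cmod \<dots> \<le> (\<Sum>j<n. cmod (?C $$ (i, j) * u $ j))" by (rule norm_sum)
  also have "\<dots> \<le> (\<Sum>j<n. M $$ (i, j) * (s * y $ j))"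
  proof (rule sum_mono)
    fix j assume "j \<in> {..<n}"
    then show "cmod (?C $$ (i, j) * u $ j) \<le> M $$ (i, j) * (s * y $ j)"
      using M_pos[OF i(1), of j] mult_left_mono[OF s_le[of j], of "M $$ (i, j)"] i(1) M_carrier
      by (simp add: norm_mult)
  qed
  also have "\<dots> = s * (M *\<^sub>v y) $ i"
    using y i mult_mat_vec_index_sum[OF M_carrier, of y i]
    by (simp add: pos_vec_def sum_distrib_left mult_ac)
  also have "\<dots> \<le> s * (max_ratio y * y $ i)"
    using mult_le_max_ratio[OF y i(1)] s by (intro mult_left_mono) auto
  finally have "cmod m * (s * y $ i) \<le> max_ratio y * (s * y $ i)" by (simp add: mult_ac)
  then show ?thesis using s ypos[OF i(1)] m(2) by simp
qed

lemma eigenvalue_le_spectral_radius: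
  assumes "eigenvalue M c"
  shows "\<bar>c\<bar> \<le> real_spectral_radius M"
proof -
  have "eigenvalue (map_mat complex_of_real M) (complex_of_real c)"
    using of_real_hom.eigenvalue_hom[OF M_carrier assms] .
  then have "cmod (complex_of_real c) \<in> norm ` spectrum (map_mat complex_of_real M)"
    unfolding spectrum_def by blast
  then show ?thesis
    using spectral_radius_mem_max(2)[of "map_mat complex_of_real M" n] M_carrier n_pos
    unfolding real_spectral_radius_def by auto
qed

text \<open>All ratios of a positive eigenvector equal its eigenvalue, which is therefore an upper
  bound for the spectral radius. In contrapositive form, a positive vector that is not a Perron
  vector is no eigenvector at all, as the strict lemmas require.\<close>

lemma positive_eigenvector_imp_perron_vector:
  assumes y: "pos_vec y" and ev: "M *\<^sub>v y = c \<cdot>\<^sub>v y"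
  shows "perron_vector M y"
proof -
  have yc: "y \<in> carrier_vec n" using y by (simp add: pos_vec_def)
  have "y \<noteq> 0\<^sub>v n" using y n_pos unfolding pos_vec_def by (metis index_zero_vec(1) order_less_irrefl)
  then have evec: "eigenvector M y c" using ev yc M_carrier by (simp add: eigenvector_def)
  obtain i where "i < n" "max_ratio y = (M *\<^sub>v y) $ i / y $ i"
    by (rule max_ratio_attained)
  then have "max_ratio y = c" using y by (auto simp: ev pos_vec_def simp del: index_mult_mat_vec)
  then have "real_spectral_radius M \<le> c" using spectral_radius_le_max_ratio[OF y] by simp
  moreover have "\<bar>c\<bar> \<le> real_spectral_radius M"
    using eigenvalue_le_spectral_radius evec unfolding eigenvalue_def by blast
  ultimately have "c = real_spectral_radius M" by linarith
  then show ?thesis using evec by (simp add: perron_vector_def)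
qed

text \<open>If the limit \<open>l\<close> of the ratios were not an eigenvalue, \<open>M - l\<close> would have an inverse \<open>N\<close>, and
  \<open>y = N ((M - l) y)\<close> would bound the iterates \<open>y\<close> by a multiple of the ratio gap times \<open>y\<close>.\<close>

lemma ratio_limit_eigenvalue:
  assumes y: "pos_vec y"
    and lb: "\<And>k. min_ratio ((M ^\<^sub>m k) *\<^sub>v y) \<le> l" and ub: "\<And>k. l \<le> max_ratio ((M ^\<^sub>m k) *\<^sub>v y)"
  shows "eigenvalue M l"
proof (rule ccontr)
  assume ne: "\<not> eigenvalue M l"
  let ?A = "char_matrix M l"
  have A: "?A \<in> carrier_mat n n" using M_carrier by simp
  have "det ?A \<noteq> 0" using ne eigenvalue_det[OF M_carrier] by simp
  from det_non_zero_imp_unit[OF A this, of "()"]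
  obtain N where N: "N \<in> carrier_mat n n" "N * ?A = 1\<^sub>m n"
    unfolding Units_def ring_mat_def by auto
  define B where "B = (\<Sum>i<n. \<Sum>j<n. \<bar>N $$ (i, j)\<bar>)"
  have B0: "0 \<le> B" unfolding B_def by (intro sum_nonneg) auto
  \<comment> \<open>Summing over all coordinates makes the estimate self-referential: the sum
    \<open>?S\<close> of the entries of \<open>u\<close> is at most \<open>B\<close> times the gap
    times \<open>?S\<close>, and \<open>?S\<close> is positive and cancels.\<close>
  have one: "1 \<le> B * (max_ratio u - min_ratio u)"
    if u: "pos_vec u" and lu: "min_ratio u \<le> l" and ul: "l \<le> max_ratio u" for u
  proof -
    have uc: "u \<in> carrier_vec n" and upos: "\<And>i. i < n \<Longrightarrow> 0 < u $ i"
      using u by (auto simp: pos_vec_def)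
    let ?S = "\<Sum>j<n. u $ j" and ?d = "max_ratio u - min_ratio u"
    have d0: "0 \<le> ?d" using min_ratio_le_max_ratio by simp
    have Au: "?A *\<^sub>v u = M *\<^sub>v u - l \<cdot>\<^sub>v u"
      using M_carrier uc unfolding char_matrix_def
      by (intro eq_vecI) (auto simp: add_scalar_prod_distrib[of _ n])
    have Au_le: "\<bar>(?A *\<^sub>v u) $ j\<bar> \<le> ?d * ?S" if j: "j < n" for j
    proof -
      have 1: "(?A *\<^sub>v u) $ j = (M *\<^sub>v u) $ j - l * u $ j"
        unfolding Au using M_carrier uc j by simp
      have "min_ratio u * u $ j \<le> l * u $ j" "l * u $ j \<le> max_ratio u * u $ j"
        using lu ul upos[OF j] by (auto intro: mult_right_mono)
      then have "\<bar>(?A *\<^sub>v u) $ j\<bar> \<le> ?d * u $ j"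
        unfolding 1 using mult_le_max_ratio[OF u j] min_ratio_mult_le[OF u j]
        by (simp add: algebra_simps del: index_mult_mat_vec)
      also have "\<dots> \<le> ?d * ?S"
        using d0 j upos by (intro mult_left_mono member_le_sum) (auto intro: less_imp_le)
      finally show ?thesis .
    qed
    have "u = N *\<^sub>v (?A *\<^sub>v u)"
      using N A uc by (metis assoc_mult_mat_vec one_mult_mat_vec)
    then have ui: "u $ i = (\<Sum>j<n. N $$ (i, j) * (?A *\<^sub>v u) $ j)" if "i < n" for i
      using mult_mat_vec_index_sum[OF N(1) mult_mat_vec_carrier[OF A uc] that] by metis
    have "u $ i \<le> (\<Sum>j<n. \<bar>N $$ (i, j)\<bar>) * (?d * ?S)" if i: "i < n" for i
    proof -
      have "u $ i \<le> (\<Sum>j<n. \<bar>N $$ (i, j)\<bar> * \<bar>(?A *\<^sub>v u) $ j\<bar>)"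
        unfolding ui[OF i] by (intro sum_mono) (simp add: abs_mult[symmetric] del: index_mult_mat_vec)
      also have "\<dots> \<le> (\<Sum>j<n. \<bar>N $$ (i, j)\<bar> * (?d * ?S))"
        using Au_le by (intro sum_mono mult_left_mono) auto
      finally show ?thesis by (simp add: sum_distrib_right)
    qed
    then have "?S \<le> (\<Sum>i<n. (\<Sum>j<n. \<bar>N $$ (i, j)\<bar>) * (?d * ?S))" by (intro sum_mono) auto
    also have "\<dots> = B * ?d * ?S" by (simp add: B_def sum_distrib_right mult.assoc)
    finally have "1 * ?S \<le> B * ?d * ?S" by simp
    moreover have "0 < ?S" using upos lessThan_n_ne by (intro sum_pos) auto
    ultimately show ?thesis by (simp only: mult_le_cancel_right_pos)
  qed
  have "(\<lambda>k. B * (max_ratio ((M ^\<^sub>m k) *\<^sub>v y) - min_ratio ((M ^\<^sub>m k) *\<^sub>v y))) \<longlonglongrightarrow> B * 0"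
    by (intro tendsto_mult_left ratio_gap_tendsto_0 y)
  moreover have "1 \<le> B * (max_ratio ((M ^\<^sub>m k) *\<^sub>v y) - min_ratio ((M ^\<^sub>m k) *\<^sub>v y))" for k
    by (intro one pos_vec_pow y lb ub)
  ultimately have "1 \<le> B * 0" by (intro LIMSEQ_le_const) auto
  then show False by simp
qed

text \<open>The ratios bound nested intervals of vanishing length, hence have a common limit
  \<open>l\<close>. As an eigenvalue, \<open>l\<close> is at most the spectral radius; conversely
  every upper ratio, and so \<open>l\<close>, is at least the spectral radius.\<close>

lemma ratios_tendsto_spectral_radius:
  assumes y: "pos_vec y"
  shows "(\<lambda>k. max_ratio ((M ^\<^sub>m k) *\<^sub>v y)) \<longlonglongrightarrow> real_spectral_radius M"
    and "(\<lambda>k. min_ratio ((M ^\<^sub>m k) *\<^sub>v y)) \<longlonglongrightarrow> real_spectral_radius M"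
proof -
  let ?a = "\<lambda>k. max_ratio ((M ^\<^sub>m k) *\<^sub>v y)" and ?b = "\<lambda>k. min_ratio ((M ^\<^sub>m k) *\<^sub>v y)"
  have yc: "y \<in> carrier_vec n" using y by (simp add: pos_vec_def)
  have "(\<lambda>k. ?b k - ?a k) \<longlonglongrightarrow> 0"
    using tendsto_minus[OF ratio_gap_tendsto_0[OF y]] by simp
  moreover have "?b k \<le> ?b (Suc k)" "?a (Suc k) \<le> ?a k" for k
    using ratio_mono[OF pos_vec_pow[OF y]] pow_mat_Suc_mult_vec[OF M_carrier yc] by metis+
  ultimately obtain l where l: "\<And>k. ?b k \<le> l" "?b \<longlonglongrightarrow> l" "\<And>k. l \<le> ?a k" "?a \<longlonglongrightarrow> l"
    using nested_sequence_unique[of ?b ?a] min_ratio_le_max_ratio by blast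
  have "\<bar>l\<bar> \<le> real_spectral_radius M"
    using ratio_limit_eigenvalue[OF y l(1,3)] by (rule eigenvalue_le_spectral_radius)
  moreover have "real_spectral_radius M \<le> l"
    using l(4) spectral_radius_le_max_ratio[OF pos_vec_pow[OF y]] by (intro LIMSEQ_le_const) auto
  ultimately have "real_spectral_radius M = l" by linarith
  with l show "?a \<longlonglongrightarrow> real_spectral_radius M" "?b \<longlonglongrightarrow> real_spectral_radius M" by auto
qed

end

section \<open>Positive definite matrices and Rayleigh quotients\<close>

lemma minus_vec_eq_zeroD:
  fixes u z :: "'a :: ab_group_add vec"
  assumes "u \<in> carrier_vec n" "z \<in> carrier_vec n" "u - z = 0\<^sub>v n"
  shows "u = z"
proof (rule eq_vecI)
  fix i assume "i < dim_vec z"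
  then have i: "i < n" using assms by simp
  then have "u $ i - z $ i = (u - z) $ i" using assms(1,2) by simp
  also have "\<dots> = 0" using assms(3) i by simp
  finally show "u $ i = z $ i" by simp
qed (use assms in auto)

text \<open>Symmetry is stated through the scalar product, the form in which it passes directly from
  a matrix to its inverse.\<close>

locale positive_definite_positive_matrix = positive_matrix +
  assumes self_adjoint: "\<And>x y. x \<in> carrier_vec n \<Longrightarrow> y \<in> carrier_vec n \<Longrightarrow> x \<bullet> (M *\<^sub>v y) = (M *\<^sub>v x) \<bullet> y"
    and positive_definite: "\<And>x. x \<in> carrier_vec n \<Longrightarrow> x \<noteq> 0\<^sub>v n \<Longrightarrow> 0 < x \<bullet> (M *\<^sub>v x)"
begin

lemma pow_carrier: "x \<in> carrier_vec n \<Longrightarrow> (M ^\<^sub>m k) *\<^sub>v x \<in> carrier_vec n"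
  using pow_carrier_mat[OF M_carrier] by (rule mult_mat_vec_carrier)

lemma mult_nonzero:
  assumes "x \<in> carrier_vec n" "x \<noteq> 0\<^sub>v n"
  shows "M *\<^sub>v x \<noteq> 0\<^sub>v n"
  using positive_definite[OF assms] assms(1) by auto

lemma pow_mult_commute:
  assumes "x \<in> carrier_vec n"
  shows "(M ^\<^sub>m k) *\<^sub>v (M *\<^sub>v x) = (M ^\<^sub>m Suc k) *\<^sub>v x"
  using assms M_carrier pow_carrier_mat[OF M_carrier, of k] by (metis assoc_mult_mat_vec pow_mat.simps(2))

text \<open>The induction goes in steps of two: self-adjointness moves one of the two extra factors
  to the left, which leaves the form of \<open>M ^\<^sub>m k\<close> at the nonzero vector
  \<open>M *\<^sub>v x\<close>.\<close>

lemma pow_positive_definite: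
  assumes "x \<in> carrier_vec n" "x \<noteq> 0\<^sub>v n"
  shows "0 < x \<bullet> ((M ^\<^sub>m k) *\<^sub>v x)"
  using assms
proof (induction k arbitrary: x rule: induct_nat_012)
  case 0
  obtain i where "i < n" "x $ i \<noteq> 0"
    using 0 by (metis carrier_vecD eq_vecI index_zero_vec)
  then have "0 < x \<bullet> x"
    unfolding scalar_prod_def using 0 by (intro sum_pos2[of _ i]) (auto simp: zero_less_mult_iff)
  then show ?case using 0 M_carrier by simp
next
  case 1
  then show ?case using positive_definite M_carrier by simp
next
  case (ge2 k)
  have "(M ^\<^sub>m Suc (Suc k)) *\<^sub>v x = M *\<^sub>v ((M ^\<^sub>m k) *\<^sub>v (M *\<^sub>v x))"
    unfolding pow_mult_commute[OF ge2.prems(1)] by (rule pow_mat_Suc_mult_vec[OF M_carrier ge2.prems(1)])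
  then have "x \<bullet> ((M ^\<^sub>m Suc (Suc k)) *\<^sub>v x) = (M *\<^sub>v x) \<bullet> ((M ^\<^sub>m k) *\<^sub>v (M *\<^sub>v x))"
    using self_adjoint ge2.prems(1) pow_carrier mult_carrier by simp
  then show ?case using ge2.IH(1) mult_carrier mult_nonzero ge2.prems by simp
qed

text \<open>Strict Cauchy--Schwarz for the inner product given by \<open>M ^\<^sub>m k\<close>, applied to \<open>x\<close> and \<open>M *\<^sub>v x\<close>.\<close>

lemma moments_strictly_log_convex:
  assumes x: "x \<in> carrier_vec n" "x \<noteq> 0\<^sub>v n" and ne: "\<And>c. M *\<^sub>v x \<noteq> c \<cdot>\<^sub>v x"
  defines "s \<equiv> \<lambda>k. x \<bullet> ((M ^\<^sub>m k) *\<^sub>v x)"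
  shows "s (Suc k) * s (Suc k) < s k * s (Suc (Suc k))"
proof -
  \<comment> \<open>This \<open>t\<close> makes \<open>u\<close> orthogonal to \<open>x\<close> in
    the form of \<open>M ^\<^sub>m k\<close>, so the cross term vanishes when the form at
    \<open>u\<close> is expanded. As \<open>x\<close> is no eigenvector, \<open>u\<close> is nonzero
    and the form is positive there.\<close>
  define t where "t = s (Suc k) / s k"
  define u where "u = M *\<^sub>v x - t \<cdot>\<^sub>v x"
  note Mx = mult_carrier[OF x(1)]
  note P = pow_carrier_mat[OF M_carrier, of k]
  have sk: "0 < s k" unfolding s_def using pow_positive_definite x by blast
  have uc: "u \<in> carrier_vec n" using x Mx by (simp add: u_def)
  have u_pow: "u \<bullet> ((M ^\<^sub>m j) *\<^sub>v x) = s (Suc j) - t * s j" for j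
  proof -
    have "u \<bullet> ((M ^\<^sub>m j) *\<^sub>v x) = (M *\<^sub>v x) \<bullet> ((M ^\<^sub>m j) *\<^sub>v x) - t * s j"
      unfolding u_def s_def using x Mx pow_carrier[OF x(1), of j]
      by (subst minus_scalar_prod_distrib[of _ n]) (auto simp del: pow_mat.simps)
    also have "(M *\<^sub>v x) \<bullet> ((M ^\<^sub>m j) *\<^sub>v x) = s (Suc j)"
      unfolding s_def pow_mat_Suc_mult_vec[OF M_carrier x(1)]
      using self_adjoint x pow_carrier by simp
    finally show ?thesis .
  qed
  have "u \<noteq> 0\<^sub>v n"
  proof
    assume "u = 0\<^sub>v n"
    then have "M *\<^sub>v x = t \<cdot>\<^sub>v x" using minus_vec_eq_zeroD[of "M *\<^sub>v x" n "t \<cdot>\<^sub>v x"] x Mx unfolding u_def by simp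
    then show False using ne by blast
  qed
  then have "0 < u \<bullet> ((M ^\<^sub>m k) *\<^sub>v u)" using pow_positive_definite uc by blast
  also have "(M ^\<^sub>m k) *\<^sub>v u = (M ^\<^sub>m Suc k) *\<^sub>v x - t \<cdot>\<^sub>v ((M ^\<^sub>m k) *\<^sub>v x)"
    unfolding u_def using x Mx P
    by (subst mult_minus_distrib_mat_vec[OF P]) (simp_all add: pow_mult_commute mult_mat_vec[OF P] del: pow_mat.simps)
  also have "u \<bullet> \<dots> = u \<bullet> ((M ^\<^sub>m Suc k) *\<^sub>v x) - t * (u \<bullet> ((M ^\<^sub>m k) *\<^sub>v x))"
    using x uc pow_carrier by (subst scalar_prod_minus_distrib[of _ n]) (auto simp del: pow_mat.simps)
  also have "\<dots> = s (Suc (Suc k)) - t * s (Suc k)"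
    unfolding u_pow using sk by (simp add: t_def)
  finally have "0 < s (Suc (Suc k)) - t * s (Suc k)" .
  then have "0 < s k * (s (Suc (Suc k)) - t * s (Suc k))" using sk by simp
  also have "\<dots> = s k * s (Suc (Suc k)) - s (Suc k) * s (Suc k)"
    using sk by (simp add: t_def field_simps)
  finally show ?thesis by simp
qed

lemma perron_sequences:
  assumes x: "pos_vec x" and np: "\<not> perron_vector M x"
  shows "strict_antimono_on {1..} (a_seq M x)" "a_seq M x \<longlonglongrightarrow> real_spectral_radius M"
    "strict_mono_on {1..} (b_seq M x)" "b_seq M x \<longlonglongrightarrow> real_spectral_radius M"
    "strict_mono_on {1..} (c_seq M x)" "c_seq M x \<longlonglongrightarrow> real_spectral_radius M"
proof -
  have xc: "x \<in> carrier_vec n" using x by (simp add: pos_vec_def)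
  have x0: "x \<noteq> 0\<^sub>v n" using x n_pos unfolding pos_vec_def by (metis index_zero_vec(1) order_less_irrefl)
  define y where "y k = (M ^\<^sub>m k) *\<^sub>v x" for k
  have y_Suc: "y (Suc k) = M *\<^sub>v y k" for k
    unfolding y_def using pow_mat_Suc_mult_vec[OF M_carrier xc] .
  have y: "pos_vec (y k)" for k unfolding y_def using pos_vec_pow[OF x] .
  have yc: "y k \<in> carrier_vec n" for k using y by (simp add: pos_vec_def)
  \<comment> \<open>The sequences start at 1 and refer to the exponent \<open>k - 1\<close>; reading
    them at \<open>Suc k\<close> avoids the truncated subtraction.\<close>
  have a: "a_seq M x (Suc k) = max_ratio (y k)" and b: "b_seq M x (Suc k) = min_ratio (y k)" for k
    using xc unfolding a_seq_def b_seq_def max_ratio_def min_ratio_def y_Suc[symmetric]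
    by (simp_all add: y_def del: pow_mat.simps index_mult_mat_vec)
  have c: "c_seq M x (Suc k) = (x \<bullet> y (Suc k)) / (x \<bullet> y k)" for k
    by (simp add: c_seq_def y_def)
  have x_ne: "M *\<^sub>v x \<noteq> d \<cdot>\<^sub>v x" for d
    using positive_eigenvector_imp_perron_vector[OF x] np by blast
  \<comment> \<open>No iterate is an eigenvector: if \<open>y (Suc k)\<close> were one for
    \<open>d\<close>, then \<open>M\<close> would annihilate
    \<open>M *\<^sub>v y k - d \<cdot>\<^sub>v y k\<close>, and by injectivity \<open>y k\<close>
    would already be one.\<close>
  have "M *\<^sub>v y k \<noteq> d \<cdot>\<^sub>v y k" for k d
  proof (induction k)
    case 0
    then show ?case using x_ne xc M_carrier by (simp add: y_def)
  next
    case (Suc k)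
    show ?case
    proof
      assume eq: "M *\<^sub>v y (Suc k) = d \<cdot>\<^sub>v y (Suc k)"
      let ?u = "M *\<^sub>v y k - d \<cdot>\<^sub>v y k"
      have "M *\<^sub>v ?u = M *\<^sub>v (M *\<^sub>v y k) - d \<cdot>\<^sub>v (M *\<^sub>v y k)"
        using yc mult_carrier[OF yc] M_carrier
        by (subst mult_minus_distrib_mat_vec[OF M_carrier]) (auto simp: mult_mat_vec[OF M_carrier])
      also have "\<dots> = 0\<^sub>v n" using eq yc mult_carrier[OF yc] by (simp add: y_Suc)
      finally have "?u = 0\<^sub>v n"
        using mult_nonzero[of ?u] yc mult_carrier[OF yc] by auto
      then have "M *\<^sub>v y k = d \<cdot>\<^sub>v y k"
        using minus_vec_eq_zeroD[OF mult_carrier[OF yc]] yc smult_carrier_vec by blast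
      then show False using Suc by blast
    qed
  qed
  then have strict: "max_ratio (y (Suc k)) < max_ratio (y k)" "min_ratio (y k) < min_ratio (y (Suc k))" for k
    using max_ratio_mult_less[OF y] min_ratio_mult_greater[OF y] by (simp_all add: y_Suc)
  have mono: "strict_mono_on {1..} f" if "\<And>k. f (Suc k) < f (Suc (Suc k))" for f :: "nat \<Rightarrow> real"
  proof (rule strict_mono_onI)
    fix r s :: nat assume "r \<in> {1..}" "s \<in> {1..}" "r < s"
    then obtain p q where "r = Suc p" "s = Suc q" "p < q"
      by (metis Suc_less_eq atLeast_iff not0_implies_Suc not_one_le_zero)
    then show "f r < f s" using lift_Suc_mono_less[of "\<lambda>k. f (Suc k)" p q] that by simp
  qed
  have "strict_mono_on {1..} (\<lambda>k. - a_seq M x k)" by (rule mono) (simp add: a strict)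
  then show "strict_antimono_on {1..} (a_seq M x)" by (simp add: monotone_on_def)
  show "strict_mono_on {1..} (b_seq M x)" by (rule mono) (simp add: b strict)
  have xy: "0 < x \<bullet> y k" for k unfolding y_def by (rule pow_positive_definite[OF xc x0])
  show "strict_mono_on {1..} (c_seq M x)"
  proof (rule mono)
    fix k
    \<comment> \<open>Strict log-convexity of the positive moments says exactly that their
      consecutive quotients increase.\<close>
    have "(x \<bullet> y (Suc k)) * (x \<bullet> y (Suc k)) < (x \<bullet> y k) * (x \<bullet> y (Suc (Suc k)))"
      using moments_strictly_log_convex[OF xc x0 x_ne] unfolding y_def .
    then show "c_seq M x (Suc k) < c_seq M x (Suc (Suc k))"
      unfolding c using xy[of k] xy[of "Suc k"] by (simp add: field_simps)
  qed
  note lim = ratios_tendsto_spectral_radius[OF x, folded y_def]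
  have aL: "(\<lambda>k. a_seq M x (Suc k)) \<longlonglongrightarrow> real_spectral_radius M"
    and bL: "(\<lambda>k. b_seq M x (Suc k)) \<longlonglongrightarrow> real_spectral_radius M"
    unfolding a b by (rule lim)+
  \<comment> \<open>\<open>c_seq\<close> is a mean of the coordinate ratios of \<open>y k\<close>
    with positive weights \<open>x $ i * y k $ i\<close>, hence lies between the extremes.\<close>
  have c_between: "b_seq M x (Suc k) \<le> c_seq M x (Suc k)" "c_seq M x (Suc k) \<le> a_seq M x (Suc k)" for k
  proof -
    have prod: "x \<bullet> y j = (\<Sum>i<n. x $ i * y j $ i)" for j
      using carrier_vecD[OF yc] by (simp add: scalar_prod_def atLeast0LessThan)
    have "min_ratio (y k) * (x \<bullet> y k) = (\<Sum>i<n. x $ i * (min_ratio (y k) * y k $ i))"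
      unfolding prod by (simp add: sum_distrib_left mult_ac)
    also have "\<dots> \<le> x \<bullet> y (Suc k)"
      unfolding prod unfolding y_Suc using min_ratio_mult_le[OF y[of k]] x
      by (intro sum_mono mult_left_mono) (auto simp: pos_vec_def simp del: index_mult_mat_vec intro: less_imp_le)
    finally show "b_seq M x (Suc k) \<le> c_seq M x (Suc k)"
      unfolding b c using xy[of k] by (simp add: field_simps)
    have "x \<bullet> y (Suc k) \<le> (\<Sum>i<n. x $ i * (max_ratio (y k) * y k $ i))"
      unfolding prod unfolding y_Suc using mult_le_max_ratio[OF y[of k]] x
      by (intro sum_mono mult_left_mono) (auto simp: pos_vec_def simp del: index_mult_mat_vec intro: less_imp_le)
    also have "\<dots> = max_ratio (y k) * (x \<bullet> y k)"
      unfolding prod by (simp add: sum_distrib_left mult_ac)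
    finally show "c_seq M x (Suc k) \<le> a_seq M x (Suc k)"
      unfolding a c using xy[of k] by (simp add: field_simps)
  qed
  have cL: "(\<lambda>k. c_seq M x (Suc k)) \<longlonglongrightarrow> real_spectral_radius M"
    by (rule tendsto_sandwich[OF _ _ bL aL]) (simp_all add: c_between)
  from aL show "a_seq M x \<longlonglongrightarrow> real_spectral_radius M" by (rule LIMSEQ_imp_Suc)
  from bL show "b_seq M x \<longlonglongrightarrow> real_spectral_radius M" by (rule LIMSEQ_imp_Suc)
  from cL show "c_seq M x \<longlonglongrightarrow> real_spectral_radius M" by (rule LIMSEQ_imp_Suc)
qed

end

section \<open>Energy and minimum principle for the Laplacian on a graph\<close>

lemma connected_invariant:
  assumes conn: "Digraph_Component.connected H" and u: "u \<in> verts H" "P u" and v: "v \<in> verts H"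
    and step: "\<And>a. a \<in> arcs H \<Longrightarrow> P (tail H a) \<longleftrightarrow> P (head H a)"
  shows "P v"
proof -
  \<comment> \<open>Connectedness is reachability in the symmetric closure, where arcs may be
    traversed backwards; hence the equivalence in \<open>step\<close>.\<close>
  have "u \<rightarrow>\<^sup>*\<^bsub>with_proj (mk_symmetric H)\<^esub> v"
    using conn u v by (simp add: connected_def strongly_connected_def)
  then show ?thesis
    unfolding reachable_def
    by (induction rule: rtrancl_on_induct) (use u step in \<open>auto simp: parcs_mk_symmetric\<close>)
qed

context weighted_pair_graph
begin

text \<open>The Laplacian acting on functions of the vertices, in difference form. Energy and
  minimum arguments are carried out here, free of row and column deletion;
  \<open>laplacian_mult\<close> links it to the matrix.\<close>

definition laplace :: "('a \<Rightarrow> real) \<Rightarrow> 'a \<Rightarrow> real" where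
  "laplace z i = (\<Sum>k | (i, k) \<in> parcs G. w i k * (z i - z k))"

lemma finite_neighbours: "finite {k. (i, k) \<in> parcs G}"
  by (rule finite_subset[OF _ pair_finite_verts]) (auto dest: in_arcsD2)

lemma arc_swap: "(i, k) \<in> parcs G \<longleftrightarrow> (k, i) \<in> parcs G"
  using arcs_symmetric by auto

text \<open>Summation by parts: swapping the ends of each arc rewrites the sum, and adding both
  versions completes the squares. The factor 2 is there because each edge is a pair of arcs.\<close>

lemma laplace_energy:
  "2 * (\<Sum>i\<in>pverts G. z i * laplace z i) = (\<Sum>(i, k)\<in>parcs G. w i k * (z i - z k)\<^sup>2)"
proof -
  have parcs_Sigma: "parcs G = (SIGMA i:pverts G. {k. (i, k) \<in> parcs G})"
    by (auto dest: in_arcsD1 in_arcsD2)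
  have E: "(\<Sum>i\<in>pverts G. z i * laplace z i) = (\<Sum>(i, k)\<in>parcs G. w i k * (z i - z k) * z i)"
    unfolding laplace_def sum_distrib_left
    by (subst (2) parcs_Sigma, subst sum.Sigma[symmetric])
      (auto intro!: finite_neighbours simp: mult_ac)
  also have "\<dots> = (\<Sum>(i, k)\<in>parcs G. w i k * (z k - z i) * z k)"
    by (rule sum.reindex_bij_witness[of _ prod.swap prod.swap])
      (auto simp: weight_sym arc_swap)
  finally have "2 * (\<Sum>i\<in>pverts G. z i * laplace z i)
      = (\<Sum>(i, k)\<in>parcs G. w i k * (z i - z k) * z i) + (\<Sum>(i, k)\<in>parcs G. w i k * (z k - z i) * z k)"
    using E by simp
  also have "\<dots> = (\<Sum>(i, k)\<in>parcs G. w i k * (z i - z k)\<^sup>2)"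
    unfolding sum.distrib[symmetric]
    by (rule sum.cong) (auto simp: power2_eq_square algebra_simps)
  finally show ?thesis .
qed

text \<open>If the energy were not positive, every square would vanish, so \<open>z\<close> would be
  constant along arcs and, by connectedness, equal to \<open>z v = 0\<close> everywhere.\<close>

lemma laplace_energy_pos:
  assumes conn: "Digraph_Component.connected (with_proj G)"
    and v: "v \<in> pverts G" "z v = 0" and j: "j \<in> pverts G" "z j \<noteq> 0"
  shows "0 < (\<Sum>i\<in>pverts G. z i * laplace z i)"
proof (rule ccontr)
  have nonneg: "0 \<le> (case a of (i, k) \<Rightarrow> w i k * (z i - z k)\<^sup>2)" if "a \<in> parcs G" for a
    using that by (cases a) (use less_imp_le[OF weight_pos] in simp)
  assume "\<not> ?thesis"
  then have "(\<Sum>(i, k)\<in>parcs G. w i k * (z i - z k)\<^sup>2) \<le> 0"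
    using laplace_energy[of z] by simp
  then have "(\<Sum>(i, k)\<in>parcs G. w i k * (z i - z k)\<^sup>2) = 0"
    using sum_nonneg[of "parcs G" "\<lambda>a. case a of (i, k) \<Rightarrow> w i k * (z i - z k)\<^sup>2"] nonneg by force
  then have "\<forall>a\<in>parcs G. (case a of (i, k) \<Rightarrow> w i k * (z i - z k)\<^sup>2) = 0"
    using sum_nonneg_eq_0_iff[of "parcs G" "\<lambda>a. case a of (i, k) \<Rightarrow> w i k * (z i - z k)\<^sup>2"] nonneg
    by simp
  then have "z i = z k" if "(i, k) \<in> parcs G" for i k
    using that weight_pos[OF that] by fastforce
  then have "z j = 0"
    using connected_invariant[OF conn, of v "\<lambda>i. z i = 0" j] v j by force
  then show False using j by simp
qed

text \<open>At a vertex where a nonpositive minimum is attained, all terms of \<open>laplace\<close>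
  are nonpositive, so a nonnegative value forces all neighbours to share the minimum. It then
  spreads through the graph without \<open>v\<close> to \<open>j\<close>, where
  \<open>laplace\<close> would be nonpositive.\<close>

lemma laplace_minimum_principle:
  assumes conn: "Digraph_Component.connected (pre_digraph.del_vert (with_proj G) v)"
    and zv: "z v = 0" and super: "\<And>i. i \<in> pverts G - {v} \<Longrightarrow> 0 \<le> laplace z i"
    and j: "j \<in> pverts G - {v}" "0 < laplace z j" and i: "i \<in> pverts G - {v}"
  shows "0 < z i"
proof (rule ccontr)
  assume neg: "\<not> 0 < z i"
  define m where "m = Min (z ` (pverts G - {v}))"
  have "m \<in> z ` (pverts G - {v})"
    unfolding m_def using i by (intro Min_in) auto
  then obtain l where l: "l \<in> pverts G - {v}" "z l = m" by auto
  have m_le: "m \<le> z k" if "k \<in> pverts G - {v}" for k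
    unfolding m_def using that by (intro Min_le) auto
  \<comment> \<open>Since \<open>z v = 0\<close>, the minimum away from \<open>v\<close> is a
    minimum over all vertices, so the neighbour \<open>v\<close> needs no separate
    treatment.\<close>
  have "m \<le> 0" using m_le[OF i] neg by simp
  then have m_le': "m \<le> z k" if "k \<in> pverts G" for k
    using that m_le zv by (cases "k = v") auto
  have le0: "w k k' * (z k - z k') \<le> 0" if "z k = m" "(k, k') \<in> parcs G" for k k'
    using that m_le'[OF in_arcsD2[OF that(2)]] weight_pos[OF that(2)] by (auto simp: mult_le_0_iff)
  have step: "z k' = m" if k: "k \<in> pverts G - {v}" "z k = m" and arc: "(k, k') \<in> parcs G" for k k'
  proof (rule ccontr)
    assume "z k' \<noteq> m"
    then have "w k k' * (z k - z k') < 0"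
      using k arc m_le'[OF in_arcsD2[OF arc]] weight_pos[OF arc] by (auto simp: mult_less_0_iff)
    then have "laplace z k < (\<Sum>l | (k, l) \<in> parcs G. 0)"
      unfolding laplace_def using le0[OF k(2)] arc finite_neighbours
      by (intro sum_strict_mono_ex1) auto
    then show False using super[OF k(1)] by simp
  qed
  have "z j = m"
  proof (rule connected_invariant[OF conn, of l])
    fix a assume "a \<in> arcs (pre_digraph.del_vert (with_proj G) v)"
    then obtain p q where "a = (p, q)" "(p, q) \<in> parcs G" "p \<noteq> v" "q \<noteq> v"
      by (cases a) (auto simp: del_vert_simps)
    then show "z (tail (pre_digraph.del_vert (with_proj G) v) a) = m \<longleftrightarrow>
        z (head (pre_digraph.del_vert (with_proj G) v) a) = m"
      using step[of p q] step[of q p] arc_swap[of p q] in_arcsD1[of p q] in_arcsD2[of p q]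
      by (auto simp: del_vert_simps)
  qed (use l j in \<open>auto simp: del_vert_simps\<close>)
  then have "laplace z j \<le> 0"
    unfolding laplace_def using le0 by (intro sum_nonpos) auto
  then show False using j by simp
qed

end

section \<open>The reduced Laplacian and the bottleneck matrix\<close>

lemma bij_betw_insert_index:
  assumes "v \<le> n"
  shows "bij_betw (insert_index v) {..<n} ({..n} - {v})"
  using insert_index_image[of v n] insert_index_inj_on[of v] assms
  by (simp add: bij_betw_def atLeast0LessThan lessThan_Suc_atMost)

locale grounded_laplacian = weighted_pair_graph G w for G :: "nat pair_pre_digraph" and w +
  fixes n v :: nat
  assumes verts: "pverts G = {..n}" and v_le: "v \<le> n"
    and conn: "Digraph_Component.connected (with_proj G)"
begin

abbreviation A :: "real mat" where
  "A \<equiv> mat_delete (laplacian G w) v v"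

text \<open>A vector indexed by the remaining rows becomes a potential grounded at \<open>v\<close>;
  the value 0 there lets the deleted column contribute nothing.\<close>

definition extend :: "real vec \<Rightarrow> nat \<Rightarrow> real" where
  "extend u k = (if k = v then 0 else u $ delete_index v k)"

lemma A_carrier: "A \<in> carrier_mat n n"
  using mat_delete_carrier[of "laplacian G w" "Suc n" "Suc n" v v] by (simp add: laplacian_def verts)

lemma extend_insert_index: "extend u (insert_index v i) = u $ i"
  by (simp add: extend_def)

lemma insert_index_vert: "i < n \<Longrightarrow> insert_index v i \<in> {..n} - {v}"
  using bij_betw_apply[OF bij_betw_insert_index[OF v_le]] by auto

lemma A_index:
  assumes "i < n" "j < n"
  shows "A $$ (i, j) = laplacian G w $$ (insert_index v i, insert_index v j)"
  using mat_delete_index[of "laplacian G w" n v v i j] assms v_le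
  by (simp add: laplacian_def verts)

lemma laplacian_mult:
  assumes i: "i \<le> n"
  shows "(\<Sum>k\<le>n. laplacian G w $$ (i, k) * z k) = laplace z i"
proof -
  have N: "{k. (i, k) \<in> parcs G} \<subseteq> {..n}" using verts in_arcsD2 by blast
  \<comment> \<open>The entry splits into its diagonal and its adjacency part; absence of loops
    keeps the two from overlapping.\<close>
  have L: "laplacian G w $$ (i, k) * z k
      = (if k = i then (\<Sum>l | (i, l) \<in> parcs G. w i l) * z i else 0)
        + (if (i, k) \<in> parcs G then - w i k * z k else 0)" if "k \<le> n" for k
    using that i no_loops[of "(i, i)"] by (auto simp: laplacian_def verts)
  have "(\<Sum>k\<le>n. laplacian G w $$ (i, k) * z k)
      = (\<Sum>l | (i, l) \<in> parcs G. w i l) * z i + (\<Sum>k\<le>n. if (i, k) \<in> parcs G then - w i k * z k else 0)"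
    using i sum.cong[OF refl L, of "{..n}"] by (simp add: sum.distrib)
  also have "(\<Sum>k\<le>n. if (i, k) \<in> parcs G then - w i k * z k else 0)
      = (\<Sum>k | (i, k) \<in> parcs G. - w i k * z k)"
    using N by (intro sum.mono_neutral_cong_right) auto
  finally show ?thesis
    by (simp add: laplace_def sum_distrib_right sum_negf sum_subtractf right_diff_distrib)
qed

text \<open>The deleted column can be put back into the row sum because it meets the value 0 of the
  extension. This carries the results on \<open>laplace\<close> over to \<open>A\<close>.\<close>

lemma A_mult_index:
  assumes u: "u \<in> carrier_vec n" and i: "i < n"
  shows "(A *\<^sub>v u) $ i = laplace (extend u) (insert_index v i)"
proof -
  let ?L = "\<lambda>k. laplacian G w $$ (insert_index v i, k) * extend u k"
  have "(A *\<^sub>v u) $ i = (\<Sum>j<n. ?L (insert_index v j))"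
    unfolding mult_mat_vec_index_sum[OF A_carrier u i]
    using i by (simp add: A_index extend_insert_index)
  also have "\<dots> = (\<Sum>k\<in>{..n} - {v}. ?L k)"
    by (rule sum.reindex_bij_betw[OF bij_betw_insert_index[OF v_le]])
  also have "\<dots> = (\<Sum>k\<le>n. ?L k)"
    by (rule sum.mono_neutral_left) (auto simp: extend_def)
  also have "\<dots> = laplace (extend u) (insert_index v i)"
    using insert_index_vert[OF i] by (intro laplacian_mult) auto
  finally show ?thesis .
qed

lemma A_self_adjoint:
  assumes "x \<in> carrier_vec n" "y \<in> carrier_vec n"
  shows "(A *\<^sub>v x) \<bullet> y = x \<bullet> (A *\<^sub>v y)"
proof -
  have "A\<^sup>T = A"
  proof (rule eq_matI)
    fix i j assume "i < dim_row A" "j < dim_col A"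
    then have ij: "i < n" "j < n" using A_carrier by auto
    \<comment> \<open>Injectivity of the renumbering ensures that diagonal entries correspond to
      diagonal entries.\<close>
    moreover have "insert_index v i = insert_index v j \<longleftrightarrow> i = j"
      by (metis delete_insert_index)
    ultimately show "A\<^sup>T $$ (i, j) = A $$ (i, j)"
      using A_carrier insert_index_vert[OF ij(1)] insert_index_vert[OF ij(2)]
        A_index[OF ij] A_index[OF ij(2,1)]
      by (auto simp: laplacian_def verts arc_swap weight_sym)
  qed (use carrier_matD[OF A_carrier] in simp_all)
  then show ?thesis
    using transpose_vec_mult_scalar[OF A_carrier, of y x] assms A_carrier
    by (metis comm_scalar_prod mult_mat_vec_carrier)
qed

text \<open>The quadratic form is the energy of the extension, which vanishes at \<open>v\<close>
  but not everywhere.\<close>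

lemma A_positive_definite:
  assumes u: "u \<in> carrier_vec n" "u \<noteq> 0\<^sub>v n"
  shows "0 < u \<bullet> (A *\<^sub>v u)"
proof -
  obtain j where j: "j < n" "u $ j \<noteq> 0"
    using u by (metis carrier_vecD eq_vecI index_zero_vec)
  let ?f = "\<lambda>k. extend u k * laplace (extend u) k"
  have "0 < (\<Sum>k\<in>pverts G. ?f k)"
  proof (rule laplace_energy_pos[OF conn, of v _ "insert_index v j"])
    show "extend u (insert_index v j) \<noteq> 0" using j by (simp add: extend_insert_index)
    show "insert_index v j \<in> pverts G" using insert_index_vert[OF j(1)] verts by auto
  qed (use v_le verts in \<open>auto simp: extend_def\<close>)
  also have "\<dots> = (\<Sum>k\<in>{..n} - {v}. ?f k)"
    unfolding verts by (rule sum.mono_neutral_right) (auto simp: extend_def)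
  also have "\<dots> = (\<Sum>i<n. ?f (insert_index v i))"
    by (rule sum.reindex_bij_betw[OF bij_betw_insert_index[OF v_le], symmetric])
  also have "\<dots> = u \<bullet> (A *\<^sub>v u)"
    using carrier_matD(1)[OF A_carrier] A_mult_index[OF u(1)]
    by (simp add: scalar_prod_def[of u] atLeast0LessThan extend_insert_index del: index_mult_mat_vec mat_delete_dim)
  finally show ?thesis .
qed

text \<open>Definiteness gives \<open>A\<close> a trivial kernel, so \<open>mat_inverse\<close>
  succeeds and the \<open>the\<close> in the definition denotes a genuine inverse.\<close>

lemma bottleneck_matrix_inverse:
  "bottleneck_matrix G w v \<in> carrier_mat n n"
  "A * bottleneck_matrix G w v = 1\<^sub>m n"
  "bottleneck_matrix G w v * A = 1\<^sub>m n"
proof -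
  have "det A \<noteq> 0"
  proof
    assume "det A = 0"
    then obtain u where u: "u \<in> carrier_vec n" "u \<noteq> 0\<^sub>v n" "A *\<^sub>v u = 0\<^sub>v n"
      using det_0_iff_vec_prod_zero_field[OF A_carrier] by auto
    then show False using A_positive_definite[OF u(1,2)] by simp
  qed
  then have "A \<in> Units (ring_mat TYPE(real) n ())"
    by (rule det_non_zero_imp_unit[OF A_carrier])
  then obtain B where "mat_inverse A = Some B"
    using mat_inverse(1)[OF A_carrier, of "()"] by (cases "mat_inverse A") auto
  then show "bottleneck_matrix G w v \<in> carrier_mat n n"
    "A * bottleneck_matrix G w v = 1\<^sub>m n" "bottleneck_matrix G w v * A = 1\<^sub>m n"
    using mat_inverse(2)[OF A_carrier] by (auto simp: bottleneck_matrix_def)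
qed

lemma A_mult_bottleneck_matrix:
  assumes "x \<in> carrier_vec n"
  shows "A *\<^sub>v (bottleneck_matrix G w v *\<^sub>v x) = x"
  using assms bottleneck_matrix_inverse A_carrier by (metis assoc_mult_mat_vec one_mult_mat_vec)

text \<open>Column \<open>j\<close> is the potential created by a unit source at \<open>j\<close>
  with \<open>v\<close> grounded. The minimum principle applies because the graph without
  \<open>v\<close> is connected.\<close>

lemma bottleneck_matrix_pos:
  assumes "\<not> cut_vertex G v" and i: "i < n" and j: "j < n"
  shows "0 < bottleneck_matrix G w v $$ (i, j)"
proof -
  let ?M = "bottleneck_matrix G w v"
  let ?u = "?M *\<^sub>v unit_vec n j"
  have u: "?u \<in> carrier_vec n" using bottleneck_matrix_inverse(1) by auto
  have lap: "laplace (extend ?u) (insert_index v k) = (if k = j then 1 else 0)" if "k < n" for k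
    using A_mult_index[OF u that] A_mult_bottleneck_matrix[of "unit_vec n j"] that j by simp
  have "0 < extend ?u (insert_index v i)"
  proof (rule laplace_minimum_principle[of v])
    show "Digraph_Component.connected (pre_digraph.del_vert (with_proj G) v)"
      using assms(1) v_le verts by (auto simp: cut_vertex_def)
    show "0 \<le> laplace (extend ?u) k" if k: "k \<in> pverts G - {v}" for k
    proof -
      obtain l where "l < n" "k = insert_index v l"
        using k bij_betw_imp_surj_on[OF bij_betw_insert_index[OF v_le]] verts by auto
      then show ?thesis using lap by simp
    qed
    show "0 < laplace (extend ?u) (insert_index v j)" using lap[OF j] by simp
  qed (use insert_index_vert i j verts in \<open>auto simp: extend_def\<close>)
  then have "0 < ?u $ i" by (simp add: extend_insert_index)
  also have "?u $ i = ?M $$ (i, j)"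
    using bottleneck_matrix_inverse(1) i j by simp
  finally show ?thesis .
qed

end

section \<open>Transfer to the bottleneck matrix\<close>

theorem theorem3p1:
  fixes G :: "nat pair_pre_digraph" and w :: "nat \<Rightarrow> nat \<Rightarrow> real"
    and n v :: nat and M :: "real mat" and x :: "real vec"
  assumes "weighted_pair_graph G w"
    and "1 \<le> n"
    and "pverts G = {..n}"
    and "Digraph_Component.connected (with_proj G)"
    and "v \<in> pverts G"
    and "\<not> cut_vertex G v"
    and "M = bottleneck_matrix G w v"
    and "x \<in> carrier_vec n"
    and "\<forall>i<n. 0 < x $ i"
    and "\<not> perron_vector M x"
  shows "strict_antimono_on {1..} (a_seq M x) \<and> a_seq M x \<longlonglongrightarrow> real_spectral_radius M \<and>
         strict_mono_on {1..} (b_seq M x) \<and> b_seq M x \<longlonglongrightarrow> real_spectral_radius M \<and>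
         strict_mono_on {1..} (c_seq M x) \<and> c_seq M x \<longlonglongrightarrow> real_spectral_radius M"
proof -
  have v: "v \<le> n" using assms(3,5) by simp
  interpret grounded_laplacian G w n v
    by (intro grounded_laplacian.intro grounded_laplacian_axioms.intro assms v)
  have M: "M \<in> carrier_mat n n" using bottleneck_matrix_inverse(1) assms(7) by simp
  have Mx: "M *\<^sub>v y \<in> carrier_vec n" "A *\<^sub>v (M *\<^sub>v y) = y" if "y \<in> carrier_vec n" for y
    using M A_mult_bottleneck_matrix that assms(7) by auto
  interpret positive_definite_positive_matrix M n
  proof
    show "0 < M $$ (i, j)" if "i < n" "j < n" for i j
      using bottleneck_matrix_pos assms(6,7) that by simp
    \<comment> \<open>Writing each vector as \<open>A\<close> applied to its image under
      \<open>M\<close> reduces symmetry of \<open>M\<close> to that of \<open>A\<close>.\<close>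
    show "x \<bullet> (M *\<^sub>v y) = (M *\<^sub>v x) \<bullet> y" if "x \<in> carrier_vec n" "y \<in> carrier_vec n" for x y
      using A_self_adjoint[OF Mx(1) Mx(1), OF that] Mx(2) that by simp
    \<comment> \<open>The form of \<open>M\<close> at \<open>x\<close> equals the form of
      \<open>A\<close> at \<open>M *\<^sub>v x\<close>, which is nonzero because \<open>A\<close>
      maps it back to \<open>x\<close>.\<close>
    show "0 < x \<bullet> (M *\<^sub>v x)" if x: "x \<in> carrier_vec n" "x \<noteq> 0\<^sub>v n" for x
    proof -
      have "B *\<^sub>v 0\<^sub>v n = 0\<^sub>v n" if "B \<in> carrier_mat n n" for B :: "real mat"
        using that by auto
      then have "M *\<^sub>v x \<noteq> 0\<^sub>v n" using A_carrier Mx(2)[OF x(1)] x(2) by metis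
      then have "0 < (M *\<^sub>v x) \<bullet> x" using A_positive_definite[OF Mx(1)[OF x(1)]] Mx(2)[OF x(1)] by simp
      then show ?thesis using comm_scalar_prod[OF Mx(1) x(1)] x(1) by simp
    qed
  qed (use M assms(2) in auto)
  have "pos_vec x" using assms(8,9) by (simp add: pos_vec_def)
  from perron_sequences[OF this assms(10)] show ?thesis by blast
qed

end
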